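(* Let $B_1=\{0,1\}$ be the two-element Boolean algebra, let $a,b,c,d\in\mathbb Z$, and let $C_n(B_1)=\mathbb ZB_1^{n+1}$ ($n\ge 0$) with boundary $\partial=\partial^{(a,b,c,d)}=a\,\partial^{( *_0)}+b\,\partial^{( *_\cup)}+c\,\partial^{( *_\cap)}+d\,\partial^{( *_\sim)}$. Let $C^{Norm}_n=C_n(B_1)/C_n^D(B_1)$ be the normalized complex and $H_n^{Norm}(B_1)$ its homology. (i) For every $n\ge0$, $C^{Norm}_n/\partial(C^{Norm}_{n+1})\cong\mathbb Z\oplus\mathbb Z_{\gcd(a+b,a+c)}$. (ii) For $n>0$, $\partial(C_n^{Norm})\cong\mathbb Z$, unless $a+b=a+c=0$, in which case $\partial(C_n^{Norm})=0$. (iii) For $n>0$, $H^{Norm}_n(B_1)\cong\mathbb Z_{\gcd(a+b,a+c)}$, unless $a+b=a+c=0$, in which case $H_n^{Norm}(B_1)\cong\mathbb Z\oplus\mathbb Z$. Moreover $H_0^{Norm}(B_1)=C_0^{Norm}/\partial(C_1^{Norm})\cong\mathbb Z\oplus\mathbb Z_{\gcd(a+b,a+c)}$.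
   Context: The operations on $B_1$ are $x*_0y=x$, $x*_\cup y=x\cup y=\max(x,y)$, $x*_\cap y=x\cap y=\min(x,y)$, $x*_\sim y=y$. For a binary operation $*$, $\partial_n^{( * )}:\mathbb ZX^{n+1}\to\mathbb ZX^n$ ($n\ge1$) is $\partial_n^{( * )}(x_0,\dots,x_n)=(x_1,\dots,x_n)+\sum_{i=1}^n(-1)^i(x_0*x_i,\dots,x_{i-1}*x_i,x_{i+1},\dots,x_n)$; the complex is not augmented ($C_{-1}=0$). $C_n^D\subset C_n$ is the subcomplex spanned by tuples $(x_0,\dots,x_n)$ with $x_i=x_{i+1}$ for some $i$. $\mathbb Z_m=\mathbb Z/m\mathbb Z$, so $\mathbb Z_0=\mathbb Z$ and $\gcd(0,0)=0$. *)

theory Defs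
  imports "HOL-Algebra.Free_Abelian_Groups"
begin

definition tuples :: "nat \<Rightarrow> 'a list set" where
  "tuples n = {xs. length xs = Suc n}"

definition degenerate_tuples :: "nat \<Rightarrow> 'a list set" where
  "degenerate_tuples n = {xs \<in> tuples n. \<exists>i<n. xs ! i = xs ! Suc i}"

definition chain_grp :: "nat \<Rightarrow> ('a list \<Rightarrow>\<^sub>0 int) monoid" where
  "chain_grp n = free_Abelian_group (tuples n)"

definition degenerate_chains :: "nat \<Rightarrow> ('a list \<Rightarrow>\<^sub>0 int) set" where
  "degenerate_chains n = carrier (free_Abelian_group (degenerate_tuples n))"

(* face opn i (x_0,...,x_n) = (x_0*x_i, ..., x_{i-1}*x_i, x_{i+1}, ..., x_n);
   for i = 0 this is (x_1,...,x_n). *)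
definition face :: "('a \<Rightarrow> 'a \<Rightarrow> 'a) \<Rightarrow> nat \<Rightarrow> 'a list \<Rightarrow> 'a list" where
  "face opn i xs = map (\<lambda>x. opn x (xs ! i)) (take i xs) @ drop (Suc i) xs"

(* The complex is not augmented: the boundary in degree 0 is the zero map. *)
definition op_boundary :: "('a \<Rightarrow> 'a \<Rightarrow> 'a) \<Rightarrow> nat \<Rightarrow> ('a list \<Rightarrow>\<^sub>0 int) \<Rightarrow> ('a list \<Rightarrow>\<^sub>0 int)" where
  "op_boundary opn n =
     (if n = 0 then (\<lambda>_. 0)
      else frag_extend (\<lambda>xs. frag_of (tl xs) +
             (\<Sum>i = 1..n. frag_cmul ((-1) ^ i) (frag_of (face opn i xs)))))"

definition lattice_boundary ::
    "int \<Rightarrow> int \<Rightarrow> int \<Rightarrow> int \<Rightarrow> nat \<Rightarrow> ('a::lattice list \<Rightarrow>\<^sub>0 int) \<Rightarrow> ('a list \<Rightarrow>\<^sub>0 int)" where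
  "lattice_boundary a b c d n z =
     frag_cmul a (op_boundary (\<lambda>x y. x) n z) + frag_cmul b (op_boundary sup n z)
     + frag_cmul c (op_boundary inf n z) + frag_cmul d (op_boundary (\<lambda>x y. y) n z)"

definition norm_chain_grp :: "nat \<Rightarrow> ('a list \<Rightarrow>\<^sub>0 int) set monoid" where
  "norm_chain_grp n = chain_grp n Mod degenerate_chains n"

(* The map induced on cosets.  As the boundary maps degenerate chains to degenerate chains, all
   members z of the coset Z give the same coset of degenerate_chains (n - 1), so that the_elem is
   applied to a singleton.  In degree 0 the map is zero and its target is the group in degree
   0 - 1 = 0 rather than the trivial group in degree -1, which leaves its kernel unchanged. *)
definition norm_boundary ::
    "int \<Rightarrow> int \<Rightarrow> int \<Rightarrow> int \<Rightarrow> nat \<Rightarrow> ('a::lattice list \<Rightarrow>\<^sub>0 int) set \<Rightarrow> ('a list \<Rightarrow>\<^sub>0 int) set" where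
  "norm_boundary a b c d n Z =
     the_elem ((\<lambda>z. degenerate_chains (n - 1) #>\<^bsub>chain_grp (n - 1)\<^esub> lattice_boundary a b c d n z) ` Z)"

(* The image of degree n chains, a subgroup of norm_chain_grp (n - 1). *)
definition norm_boundary_image ::
    "int \<Rightarrow> int \<Rightarrow> int \<Rightarrow> int \<Rightarrow> nat \<Rightarrow> ('a::lattice list \<Rightarrow>\<^sub>0 int) set set" where
  "norm_boundary_image a b c d n = norm_boundary a b c d n ` carrier (norm_chain_grp n)"

definition norm_cycles ::
    "int \<Rightarrow> int \<Rightarrow> int \<Rightarrow> int \<Rightarrow> nat \<Rightarrow> ('a::lattice list \<Rightarrow>\<^sub>0 int) set set" where
  "norm_cycles a b c d n =
     kernel (norm_chain_grp n) (norm_chain_grp (n - 1)) (norm_boundary a b c d n)"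

definition norm_homology ::
    "int \<Rightarrow> int \<Rightarrow> int \<Rightarrow> int \<Rightarrow> nat \<Rightarrow> ('a::lattice list \<Rightarrow>\<^sub>0 int) set set monoid" where
  "norm_homology a b c d n =
     subgroup_generated (norm_chain_grp n) (norm_cycles a b c d n)
       Mod norm_boundary_image a b c d (Suc n)"

end

theory Submission
  imports Defs
begin

text \<open>Over \<open>B\<^sub>1\<close> only the two alternating tuples of each length are nondegenerate, so every
  \<open>C\<^sub>n\<^sup>N\<^sup>o\<^sup>r\<^sup>m\<close> is \<open>\<int>\<^sup>2\<close>. Write \<open>(a + b, a + c) = g (p, q)\<close> with \<open>g\<close> the gcd and \<open>p, q\<close> coprime, and put
  \<open>w\<^sub>n = (-1, 1)\<close> for even \<open>n\<close> and \<open>w\<^sub>n = (p, q)\<close> for odd \<open>n\<close>. In these coordinates the boundary is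
  \<open>v \<mapsto> g det(v, w\<^sub>n) w\<^sub>n\<^sub>-\<^sub>1\<close>. As \<open>w\<^sub>n\<close> is primitive, the boundaries in degree \<open>n\<close> are the multiples of
  \<open>g w\<^sub>n\<close> and, for \<open>g \<noteq> 0\<close> and \<open>n > 0\<close>, the cycles are the multiples of \<open>w\<^sub>n\<close>.\<close>

subsection \<open>Faces of alternating tuples\<close>

definition alternating :: "bool \<Rightarrow> nat \<Rightarrow> bool list" where
  "alternating s n = map (\<lambda>i. s \<noteq> odd i) [0..<Suc n]"

lemma length_alternating [simp]: "length (alternating s n) = Suc n"
  by (simp add: alternating_def)

lemma nth_alternating: "i \<le> n \<Longrightarrow> alternating s n ! i = (s \<noteq> odd i)"
  by (simp add: alternating_def del: upt_Suc)

lemma alternating_inject [simp]: "alternating s n = alternating t n \<longleftrightarrow> s = t"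
  using nth_alternating[of 0 n s] nth_alternating[of 0 n t] by auto

lemma alternating_in_tuples [simp]: "alternating s n \<in> tuples n"
  by (simp add: tuples_def)

lemma alternating_not_degenerate [simp]: "alternating s n \<notin> degenerate_tuples n"
  by (auto simp: degenerate_tuples_def nth_alternating)

text \<open>Adjacent entries of a nondegenerate tuple differ; with only two letters this makes each
  entry the negation of its predecessor.\<close>

lemma nondegenerate_imp_alternating:
  assumes "xs \<in> tuples n" "xs \<notin> degenerate_tuples n"
  shows "xs = alternating (hd xs) n"
proof (rule nth_equalityI)
  have len: "length xs = Suc n"
    using assms(1) by (simp add: tuples_def)
  then show "length xs = length (alternating (hd xs) n)"
    by simp
  have "i \<le> n \<Longrightarrow> xs ! i = (hd xs \<noteq> odd i)" for i
  proof (induction i)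
    case 0
    then show ?case using len by (cases xs) auto
  next
    case (Suc i)
    then show ?case using assms by (auto simp: degenerate_tuples_def Suc_le_eq)
  qed
  then show "xs ! i = alternating (hd xs) n ! i" if "i < length xs" for i
    using that len by (simp add: nth_alternating)
qed

lemma tuples_bool:
  "(tuples n :: bool list set) = degenerate_tuples n \<union> range (\<lambda>s. alternating s n)"
proof (intro subset_antisym subsetI)
  fix xs :: "bool list"
  assume "xs \<in> tuples n"
  then show "xs \<in> degenerate_tuples n \<union> range (\<lambda>s. alternating s n)"
    using nondegenerate_imp_alternating by blast
qed (auto simp: degenerate_tuples_def)

section \<open>Boundary coefficients of degenerate and of alternating tuples\<close>

lemma length_face: "length xs = Suc n \<Longrightarrow> i \<le> n \<Longrightarrow> length (face opn i xs) = n"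
  by (simp add: face_def)

lemma nth_face:
  assumes "length xs = Suc n" "i \<le> n" "k < n"
  shows "face opn i xs ! k = (if k < i then opn (xs ! k) (xs ! i) else xs ! Suc k)"
  using assms by (auto simp: face_def nth_append min_def)

lemma face_in_tuples: "xs \<in> tuples n \<Longrightarrow> i \<le> n \<Longrightarrow> 0 < n \<Longrightarrow> face opn i xs \<in> tuples (n - 1)"
  by (simp add: tuples_def length_face)

lemma face_degenerate:
  assumes "length xs = Suc n" "i \<le> n" "Suc k < n" "face opn i xs ! k = face opn i xs ! Suc k"
  shows "face opn i xs \<in> degenerate_tuples (n - 1)"
  using assms by (auto simp: degenerate_tuples_def tuples_def length_face intro!: exI[of _ k])

text \<open>The separate term \<open>tl xs\<close> is the face with index 0 and sign +1, which turns
  the boundary into one uniform alternating sum.\<close>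

lemma op_boundary_frag_of:
  assumes "0 < n"
  shows "op_boundary opn n (frag_of xs)
    = (\<Sum>i\<le>n. frag_cmul ((-1) ^ i) (frag_of (face opn i xs)))"
proof -
  have "{..n} = insert 0 {1..n}" by auto
  moreover have "face opn 0 xs = tl xs"
    by (simp add: face_def drop_Suc)
  ultimately show ?thesis
    using assms by (simp add: op_boundary_def)
qed

lemma lookup_op_boundary:
  assumes "0 < n"
  shows "Poly_Mapping.lookup (op_boundary opn n (frag_of xs)) ys
    = (\<Sum>i\<le>n. (-1) ^ i * of_bool (face opn i xs = ys))"
  using assms
  by (auto simp: op_boundary_frag_of Poly_Mapping.lookup_sum of_bool_def intro!: sum.cong)

lemma keys_op_boundary:
  assumes "0 < n" "Poly_Mapping.keys z \<subseteq> tuples n"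
  shows "Poly_Mapping.keys (op_boundary opn n z) \<subseteq> tuples (n - 1)"
  using assms(2)
proof (induction z rule: frag_induction)
  case zero
  then show ?case using assms(1) by (simp add: op_boundary_def)
next
  case (one xs)
  have "Poly_Mapping.keys (\<Sum>i\<le>n. frag_cmul ((-1) ^ i) (frag_of (face opn i xs)))
      \<subseteq> (\<Union>i\<le>n. {face opn i xs})"
    by (rule order_trans[OF keys_sum]) auto
  also have "\<dots> \<subseteq> tuples (n - 1)"
    using face_in_tuples[OF one _ assms(1)] by blast
  finally show ?case
    using assms(1) by (simp add: op_boundary_frag_of)
next
  case (diff x y)
  then show ?case
    using assms(1) keys_diff by (fastforce simp: op_boundary_def frag_extend_diff)
qed

text \<open>If entries \<open>j\<close> and \<open>Suc j\<close> agree, idempotence makes the faces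
  \<open>j\<close> and \<open>Suc j\<close> equal and their opposite signs cancel, while every other
  face still has two equal neighbours. So degenerate tuples do not affect the coefficients that
  survive normalization.\<close>

lemma lookup_op_boundary_degenerate:
  assumes idem: "\<And>x. opn x x = x" and "0 < n" and xs: "xs \<in> degenerate_tuples n"
    and ys: "ys \<notin> degenerate_tuples (n - 1)"
  shows "Poly_Mapping.lookup (op_boundary opn n (frag_of xs)) ys = 0"
proof -
  obtain j where j: "j < n" "xs ! j = xs ! Suc j" and len: "length xs = Suc n"
    using xs by (auto simp: degenerate_tuples_def tuples_def)
  have other: "face opn i xs \<noteq> ys" if "i \<le> n" "i \<noteq> j" "i \<noteq> Suc j" for i
  proof (cases "i < j")
    case True
    have "face opn i xs \<in> degenerate_tuples (n - 1)"
      \<comment> \<open>Deleting an entry before \<open>j\<close> moves the equal pair one place to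
        the left.\<close>
      by (rule face_degenerate[OF len, of _ "j - 1"]) (use True that j in \<open>auto simp: nth_face[OF len]\<close>)
    then show ?thesis using ys by auto
  next
    case False
    have "face opn i xs \<in> degenerate_tuples (n - 1)"
      \<comment> \<open>Here \<open>i > Suc j\<close>: both entries of the pair are acted on by
        \<open>xs ! i\<close>, so they remain equal and in place.\<close>
      by (rule face_degenerate[OF len, of _ j]) (use False that j in \<open>auto simp: nth_face[OF len]\<close>)
    then show ?thesis using ys by auto
  qed
  have same: "face opn (Suc j) xs = face opn j xs"
    by (rule nth_equalityI) (use j idem in \<open>auto simp: length_face[OF len] nth_face[OF len] less_Suc_eq\<close>)
  have "(\<Sum>i\<le>n. (-1) ^ i * of_bool (face opn i xs = ys))
      = (\<Sum>i\<in>{j, Suc j}. (-1) ^ i * (of_bool (face opn i xs = ys) :: int))"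
    by (rule sum.mono_neutral_right) (use j other in auto)
  also have "\<dots> = 0"
    by (simp add: same del: sum_mult_of_bool_eq)
  finally show ?thesis
    using assms(2) by (simp add: lookup_op_boundary)
qed

text \<open>For idempotent \<open>opn\<close> and \<open>x\<^sub>i\<^sub>-\<^sub>1 \<noteq> x\<^sub>i\<close>, the \<open>i\<close>-th face of an alternating tuple starts with \<open>i\<close>
  copies of \<open>x\<^sub>i\<close> or leaves \<open>x\<^sub>0, \<dots>, x\<^sub>i\<^sub>-\<^sub>1\<close> unchanged, so only the faces \<open>0\<close>, \<open>1\<close> and \<open>n\<close> can be
  nondegenerate.\<close>
lemma lookup_op_boundary_alternating:
  fixes opn :: "bool \<Rightarrow> bool \<Rightarrow> bool"
  assumes idem: "\<And>x. opn x x = x" and "0 < n"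
  defines "keep \<equiv> \<lambda>x. opn (\<not> x) x = (\<not> x)"
  shows "Poly_Mapping.lookup (op_boundary opn n (frag_of (alternating s n))) (alternating t (n - 1))
    = of_bool (keep (\<not> s) \<and> t = (\<not> s)) + (-1) ^ n * of_bool (keep (s \<noteq> odd n) \<and> t = s)"
proof -
  let ?f = "\<lambda>i. (-1) ^ i * (of_bool (face opn i (alternating s n) = alternating t (n - 1)) :: int)"
  have len: "length (alternating s n) = Suc n" by simp
  have nth: "face opn i (alternating s n) ! k =
      (if k < i then opn (s \<noteq> odd k) (s \<noteq> odd i) else (s \<noteq> even k))" if "i \<le> n" "k < n" for i k
    using that by (simp add: nth_face[OF len] nth_alternating)
  have eq_iff: "face opn i (alternating s n) = alternating t (n - 1)
      \<longleftrightarrow> (\<forall>k<n. (if k < i then opn (s \<noteq> odd k) (s \<noteq> odd i) else (s \<noteq> even k)) = (t \<noteq> odd k))"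
    if "i \<le> n" for i
    using that \<open>0 < n\<close> length_face[OF len that]
    by (auto simp: list_eq_iff_nth_eq nth nth_alternating)
  have f0: "?f 0 = of_bool (t = (\<not> s))"
  proof -
    have "(\<forall>k<n. (s \<noteq> even k) = (t \<noteq> odd k)) \<longleftrightarrow> t = (\<not> s)"
      using \<open>0 < n\<close> by auto
    then show ?thesis
      using eq_iff[of 0] by simp
  qed
  show ?thesis
  \<comment> \<open>For \<open>n = 1\<close> the faces 1 and \<open>n\<close> coincide, so the sum
    over \<open>{0, 1, n}\<close> used below would not split into three terms.\<close>
  proof (cases "n = 1")
    case True
    have "face opn 1 (alternating s 1) = alternating t 0 \<longleftrightarrow> opn s (\<not> s) = t"
      using True eq_iff[of 1] by simp
    then show ?thesis
      using True f0 idem unfolding keep_def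
      by (cases s; cases t; simp add: lookup_op_boundary)
  next
    case False
    then have n: "2 \<le> n" using \<open>0 < n\<close> by simp
    \<comment> \<open>If \<open>keep (\<not> s)\<close> fails, face 1 agrees with face 0 and cancels
      it. Otherwise it begins with x_0, x_2, which are equal, and is degenerate. Faces 0 and 1
      together thus give the first term of the claim.\<close>
    have f1: "?f 1 = - of_bool (\<not> keep (\<not> s) \<and> t = (\<not> s))"
    proof -
      have "?f 1 = - of_bool (\<forall>k<n. (if k = 0 then opn s (\<not> s) else (s \<noteq> even k)) = (t \<noteq> odd k))"
        using n eq_iff[of 1] by simp
      moreover have "(\<forall>k<n. (if k = 0 then opn s (\<not> s) else (s \<noteq> even k)) = (t \<noteq> odd k))
          \<longleftrightarrow> \<not> keep (\<not> s) \<and> t = (\<not> s)" (is "?l \<longleftrightarrow> ?r")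
      proof
        assume l: ?l
        from l[rule_format, of 0] l[rule_format, of 1] n show ?r
          by (auto simp: keep_def)
      next
        assume ?r
        then show ?l by (auto simp: keep_def)
      qed
      ultimately show ?thesis by simp
    qed
    \<comment> \<open>On two letters, idempotence leaves only two choices for
      \<open>\<lambda>y. opn y x\<close>: the constant \<open>x\<close> or the identity.\<close>
    have const: "opn y x = x" if "\<not> keep x" for x y
      using that idem unfolding keep_def by (cases x; cases y) auto
    have id: "opn y x = y" if "keep x" for x y
      using that idem unfolding keep_def by (cases x; cases y) auto
    have face_keep: "face opn i (alternating s n) = alternating t (n - 1)
        \<longleftrightarrow> (\<forall>k<n. (if k < i then s \<noteq> odd k else s \<noteq> even k) = (t \<noteq> odd k))"
      if "i \<le> n" "keep (s \<noteq> odd i)" for i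
      by (simp only: eq_iff[OF that(1)] id[OF that(2)])
    have face_const: "face opn i (alternating s n) = alternating t (n - 1)
        \<longleftrightarrow> (\<forall>k<n. (if k < i then s \<noteq> odd i else s \<noteq> even k) = (t \<noteq> odd k))"
      if "i \<le> n" "\<not> keep (s \<noteq> odd i)" for i
      by (simp only: eq_iff[OF that(1)] const[OF that(2)])
    have const_False: "face opn i (alternating s n) \<noteq> alternating t (n - 1)"
      if "i \<le> n" "2 \<le> i" "\<not> keep (s \<noteq> odd i)" for i
    proof
      assume "face opn i (alternating s n) = alternating t (n - 1)"
      then have *: "(if k < i then s \<noteq> odd i else s \<noteq> even k) = (t \<noteq> odd k)" if "k < n" for k
        using that face_const[OF \<open>i \<le> n\<close> \<open>\<not> keep (s \<noteq> odd i)\<close>] by blast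
      from *[of 0] *[of 1] that(1,2) show False by simp
    qed
    have fn: "?f n = (-1) ^ n * of_bool (keep (s \<noteq> odd n) \<and> t = s)"
    proof (cases "keep (s \<noteq> odd n)")
      case True
      have "(\<forall>k<n. (if k < n then s \<noteq> odd k else s \<noteq> even k) = (t \<noteq> odd k)) \<longleftrightarrow> t = s"
        using n by (auto dest: spec[of _ 0])
      with face_keep[OF _ True] True show ?thesis by simp
    next
      case False
      with const_False[OF _ n] show ?thesis by simp
    qed
    have other: "?f i = 0" if "i \<le> n" "i \<noteq> 0" "i \<noteq> 1" "i \<noteq> n" for i
    proof (cases "keep (s \<noteq> odd i)")
      case True
      have "face opn i (alternating s n) \<noteq> alternating t (n - 1)"
      proof
        assume "face opn i (alternating s n) = alternating t (n - 1)"
        then have *: "(if k < i then s \<noteq> odd k else s \<noteq> even k) = (t \<noteq> odd k)" if "k < n" for k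
          using that face_keep[OF \<open>i \<le> n\<close> True] by blast
        \<comment> \<open>With the other entries unchanged, deleting x_i puts x_{i-1} next to
          x_{i+1}, and these two are equal.\<close>
        from *[of "i - 1"] *[of i] that show False by (cases i) auto
      qed
      then show ?thesis by simp
    next
      case False
      with const_False[OF that(1)] that show ?thesis by simp
    qed
    have "(\<Sum>i\<le>n. ?f i) = (\<Sum>i\<in>{0, 1, n}. ?f i)"
      by (rule sum.mono_neutral_right) (use n other in auto)
    also have "\<dots> = ?f 0 + ?f 1 + ?f n"
      using n by simp
    finally have sum: "(\<Sum>i\<le>n. ?f i) = ?f 0 + ?f 1 + ?f n" .
    show ?thesis
      unfolding lookup_op_boundary[OF \<open>0 < n\<close>] sum f0 f1 fn by simp
  qed
qed

text \<open>The weight \<open>w x\<close> sums the coefficients of the operations for which acting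
  by \<open>x\<close> changes nothing: the first projection always, \<open>sup\<close> for
  \<open>x = False\<close>, \<open>inf\<close> for \<open>x = True\<close>, the second projection
  never. Hence \<open>d\<close> drops out and only \<open>a + b\<close> and \<open>a + c\<close>
  remain.\<close>

lemma lookup_lattice_boundary:
  fixes a b c d :: int and z :: "bool list \<Rightarrow>\<^sub>0 int"
  assumes n: "0 < n" and z: "Poly_Mapping.keys z \<subseteq> tuples n"
  defines "w \<equiv> \<lambda>s. if s then a + c else a + b"
  shows "Poly_Mapping.lookup (lattice_boundary a b c d n z) (alternating t (n - 1))
    = w t * Poly_Mapping.lookup z (alternating (\<not> t) n)
      + (-1) ^ n * w (t \<noteq> odd n) * Poly_Mapping.lookup z (alternating t n)"
  using z
proof (induction z rule: frag_induction)
  case zero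
  show ?case using n by (simp add: lattice_boundary_def op_boundary_def)
next
  case (diff x y)
  then show ?case
    using n by (simp add: lattice_boundary_def op_boundary_def frag_extend_diff
      Poly_Mapping.lookup_add Poly_Mapping.lookup_minus algebra_simps)
next
  case (one xs)
  show ?case
  proof (cases "xs \<in> degenerate_tuples n")
    case True
    then have "xs \<noteq> alternating s n" "alternating s n \<noteq> xs" for s by auto
    moreover have "alternating t (n - Suc 0) \<notin> degenerate_tuples (n - Suc 0)" by simp
    ultimately show ?thesis
      using True n by (simp add: lattice_boundary_def Poly_Mapping.lookup_add
        lookup_op_boundary_degenerate)
  next
    case False
    then obtain s where xs: "xs = alternating s n"
      using one nondegenerate_imp_alternating by blast
    note [simp] = lookup_op_boundary_alternating[OF _ n, simplified]
    show ?thesis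
      unfolding xs w_def
      by (cases s; cases t; cases "even n")
        (simp_all add: lattice_boundary_def Poly_Mapping.lookup_add n)
  qed
qed

subsection \<open>Quotients of \<open>\<int>\<^sup>2\<close> by multiples of a primitive vector\<close>

lemma (in group_hom) the_elem_image_coset:
  assumes "x \<in> carrier G"
  shows "the_elem (h ` (kernel G H h #> x)) = h x"
proof (rule the_elem_image_unique)
  show "kernel G H h #> x \<noteq> {}"
    using G.rcos_self[OF assms subgroup_kernel] by blast
  fix y assume "y \<in> kernel G H h #> x"
  then obtain e where "e \<in> kernel G H h" "y = e \<otimes> x"
    unfolding r_coset_def by blast
  then show "h y = h x"
    using assms by (simp add: kernel_def)
qed

lemma (in group_hom) kernel_coset_eqI:
  assumes "x \<in> carrier G" "y \<in> carrier G" "h x = h y"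
  shows "kernel G H h #> x = kernel G H h #> y"
  using FactGroup_subset[OF assms] FactGroup_subset[OF assms(2,1) assms(3)[symmetric]]
  by (rule subset_antisym)

abbreviation (input) ZZ :: "(int \<times> int) monoid" where
  "ZZ \<equiv> integer_group \<times>\<times> integer_group"

lemma carrier_ZZ [simp]: "carrier ZZ = UNIV"
  by (simp add: DirProd_def)

lemma group_ZZ [simp]: "group ZZ"
  by (simp add: DirProd_group)

definition multiples :: "int \<Rightarrow> int \<times> int \<Rightarrow> (int \<times> int) set" where
  "multiples k w = range (\<lambda>t. (k * t * fst w, k * t * snd w))"

text \<open>The functional with Bezout coefficients \<open>u\<close>, \<open>v\<close> takes the
  value 1 on \<open>w\<close>. A vector with vanishing determinant against \<open>w\<close> is
  therefore \<open>w\<close> times its value under the functional. Membership becomes a condition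
  that can be read off as the kernel of a homomorphism.\<close>

lemma mem_multiples_iff:
  assumes "u * fst w + v * snd w = 1"
  shows "(x, y) \<in> multiples k w \<longleftrightarrow> x * snd w = y * fst w \<and> k dvd u * x + v * y"
proof
  assume "(x, y) \<in> multiples k w"
  then obtain t where t: "x = k * t * fst w" "y = k * t * snd w"
    by (auto simp: multiples_def)
  have "u * x + v * y = k * t * (u * fst w + v * snd w)"
    by (simp add: t algebra_simps)
  then show "x * snd w = y * fst w \<and> k dvd u * x + v * y"
    using assms by (simp add: t)
next
  assume *: "x * snd w = y * fst w \<and> k dvd u * x + v * y"
  then obtain t where t: "u * x + v * y = k * t" by blast
  have "x = x * (u * fst w + v * snd w)" using assms by simp
  also have "\<dots> = (u * x + v * y) * fst w" using * by (simp add: algebra_simps)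
  also have "\<dots> = k * t * fst w" by (simp only: t)
  finally have 1: "x = k * t * fst w" .
  have "y = y * (u * fst w + v * snd w)" using assms by simp
  also have "\<dots> = (u * x + v * y) * snd w" using * by (simp add: algebra_simps)
  also have "\<dots> = k * t * snd w" by (simp only: t)
  finally have "y = k * t * snd w" .
  with 1 show "(x, y) \<in> multiples k w"
    by (auto simp: multiples_def)
qed

text \<open>The case \<open>n = 0\<close> is included: \<open>integer_mod_group 0\<close> is the
  group of all integers, and \<open>x mod 0 = x\<close>.\<close>

lemma mod_in_integer_mod_group: "x mod int n \<in> carrier (integer_mod_group n)"
  by (simp add: carrier_integer_mod_group)

lemma mod_self_integer_mod_group: "x \<in> carrier (integer_mod_group n) \<Longrightarrow> x mod int n = x"
  by (simp add: carrier_integer_mod_group split: if_splits)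

text \<open>Groups of cosets are accessed only through an isomorphism with the integer plane, so
  quotients and subgroups are computed there.\<close>

locale coordinates = group +
  fixes \<Phi>
  assumes iso: "\<Phi> \<in> iso G ZZ"
begin

definition line :: "int \<Rightarrow> int \<times> int \<Rightarrow> 'a set" where
  "line k w = {x \<in> carrier G. \<Phi> x \<in> multiples k w}"

lemma \<Phi>_mult:
  "x \<in> carrier G \<Longrightarrow> y \<in> carrier G
    \<Longrightarrow> \<Phi> (x \<otimes> y) = (fst (\<Phi> x) + fst (\<Phi> y), snd (\<Phi> x) + snd (\<Phi> y))"
  using iso by (auto simp: iso_def hom_def mult_DirProd' integer_group_def)

lemma \<Phi>_one: "\<Phi> \<one> = (0, 0)"
  using hom_one[of \<Phi> G ZZ] iso is_group by (auto simp: iso_def)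

lemma \<Phi>_surj: obtains x where "x \<in> carrier G" "\<Phi> x = v"
proof -
  have "v \<in> \<Phi> ` carrier G"
    using iso by (simp add: iso_def bij_betw_def)
  with that show thesis by blast
qed

lemma \<Phi>_inj: "x \<in> carrier G \<Longrightarrow> y \<in> carrier G \<Longrightarrow> \<Phi> x = \<Phi> y \<longleftrightarrow> x = y"
  using iso by (auto simp: iso_def bij_betw_def inj_on_def)

lemma mem_line_iff:
  assumes "u * fst w + v * snd w = 1"
  shows "x \<in> line k w \<longleftrightarrow> x \<in> carrier G \<and> fst (\<Phi> x) * snd w = snd (\<Phi> x) * fst w
    \<and> k dvd u * fst (\<Phi> x) + v * snd (\<Phi> x)"
  using mem_multiples_iff[OF assms, of "fst (\<Phi> x)" "snd (\<Phi> x)"] by (simp add: line_def)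

lemma lineI:
  "x \<in> carrier G \<Longrightarrow> \<Phi> x = (k * t * fst w, k * t * snd w) \<Longrightarrow> x \<in> line k w"
  unfolding line_def multiples_def by blast

lemma lineE:
  assumes "x \<in> line k w"
  obtains t where "x \<in> carrier G" "\<Phi> x = (k * t * fst w, k * t * snd w)"
  using assms unfolding line_def multiples_def by blast

lemma subgroup_line: "subgroup (line k w) G"
proof
  show "line k w \<subseteq> carrier G"
    unfolding line_def by blast
next
  show "\<one> \<in> line k w"
    by (rule lineI[where t = 0]) (simp_all add: \<Phi>_one)
next
  fix x y assume "x \<in> line k w" "y \<in> line k w"
  then obtain s t where *: "x \<in> carrier G" "y \<in> carrier G"
    "\<Phi> x = (k * s * fst w, k * s * snd w)" "\<Phi> y = (k * t * fst w, k * t * snd w)"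
    by (elim lineE)
  show "x \<otimes> y \<in> line k w"
    by (rule lineI[where t = "s + t"]) (simp_all add: * \<Phi>_mult algebra_simps)
next
  fix x assume "x \<in> line k w"
  then obtain t where t: "x \<in> carrier G" "\<Phi> x = (k * t * fst w, k * t * snd w)"
    by (rule lineE)
  have "(k * t * fst w + fst (\<Phi> (inv x)), k * t * snd w + snd (\<Phi> (inv x))) = (0, 0)"
    using \<Phi>_mult[OF t(1) inv_closed[OF t(1)]] t by (simp add: \<Phi>_one)
  then have "\<Phi> (inv x) = (k * (- t) * fst w, k * (- t) * snd w)"
    by (simp add: prod_eq_iff eq_neg_iff_add_eq_0 add.commute)
  with t(1) show "inv x \<in> line k w"
    by (intro lineI inv_closed)
qed

text \<open>Determinant against \<open>w\<close> and Bezout functional form a unimodular change of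
  coordinates taking \<open>w\<close> to (0, 1). Reducing the second coordinate modulo
  \<open>m\<close> gives a surjection with kernel \<open>line (int m) w\<close>;
  \<open>m = 0\<close> is allowed.\<close>

lemma quotient_line:
  assumes w: "coprime (fst w) (snd w)"
  shows "G Mod line (int m) w \<cong> integer_group \<times>\<times> integer_mod_group (m)"
proof -
  let ?H = "integer_group \<times>\<times> integer_mod_group (m)"
  obtain u v where uv: "u * fst w + v * snd w = 1"
    using bezout_int[of "fst w" "snd w"] w by auto
  define f where "f = (\<lambda>x. (fst (\<Phi> x) * snd w - snd (\<Phi> x) * fst w,
    (u * fst (\<Phi> x) + v * snd (\<Phi> x)) mod int m))"
  have grp: "group ?H"
    by (simp add: DirProd_group)
  have f: "f \<in> hom G ?H"
    by (rule homI) (auto simp: f_def \<Phi>_mult mult_DirProd integer_group_def mod_in_integer_mod_group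
        mod_add_eq algebra_simps)
  interpret f: group_hom G ?H f
    using f grp by (simp add: group_hom_def group_hom_axioms_def is_group)
  have "carrier ?H \<subseteq> f ` carrier G"
  proof
    fix y assume "y \<in> carrier ?H"
    then obtain r s where y: "y = (r, s)" "s mod int m = s"
      by (auto simp: mod_self_integer_mod_group)
    \<comment> \<open>The preimage is r (v, -u) + s w: the vector (v, -u) has determinant 1 against
      \<open>w\<close> and is killed by the functional.\<close>
    obtain x where x: "x \<in> carrier G" "\<Phi> x = (r * v + s * fst w, s * snd w - r * u)"
      using \<Phi>_surj by blast
    have "(r * v + s * fst w) * snd w - (s * snd w - r * u) * fst w = r * (u * fst w + v * snd w)"
      "u * (r * v + s * fst w) + v * (s * snd w - r * u) = s * (u * fst w + v * snd w)"
      by (simp_all add: algebra_simps)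
    then have "f x = y"
      using uv y by (simp add: f_def x)
    with x show "y \<in> f ` carrier G" by blast
  qed
  then have "f ` carrier G = carrier ?H"
    using hom_carrier[OF f] by blast
  moreover have "kernel G ?H f = line (int m) w"
    by (auto simp: kernel_def f_def mem_line_iff[OF uv] one_DirProd integer_group_def
        mod_eq_0_iff_dvd)
  ultimately show ?thesis
    using f.FactGroup_iso by simp
qed

lemma line_cong_integer_group:
  assumes w: "coprime (fst w) (snd w)" and k: "k \<noteq> 0"
  shows "subgroup_generated G (line k w) \<cong> integer_group"
proof -
  obtain u v where uv: "u * fst w + v * snd w = 1"
    using bezout_int[of "fst w" "snd w"] w by auto
  \<comment> \<open>The functional is k t on k t w, so division by \<open>k\<close> recovers the
    multiplier t.\<close>
  define f where "f = (\<lambda>x. (u * fst (\<Phi> x) + v * snd (\<Phi> x)) div k)"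
  have carr: "carrier (subgroup_generated G (line k w)) = line k w"
    by (simp add: subgroup.carrier_subgroup_generated_subgroup[OF subgroup_line])
  have f: "f x = t" if "\<Phi> x = (k * t * fst w, k * t * snd w)" for x t
  proof -
    have "u * fst (\<Phi> x) + v * snd (\<Phi> x) = k * t * (u * fst w + v * snd w)"
      by (simp add: that algebra_simps)
    then show ?thesis using uv k by (simp add: f_def)
  qed
  have "f \<in> iso (subgroup_generated G (line k w)) integer_group"
  proof (rule isoI)
    show "f \<in> hom (subgroup_generated G (line k w)) integer_group"
    proof (rule homI)
      fix x y assume "x \<in> carrier (subgroup_generated G (line k w))"
        "y \<in> carrier (subgroup_generated G (line k w))"
      then obtain s t where *: "x \<in> carrier G" "y \<in> carrier G"
        "\<Phi> x = (k * s * fst w, k * s * snd w)" "\<Phi> y = (k * t * fst w, k * t * snd w)"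
        unfolding carr by (elim lineE)
      then have "\<Phi> (x \<otimes> y) = (k * (s + t) * fst w, k * (s + t) * snd w)"
        by (simp add: \<Phi>_mult algebra_simps)
      then show "f (x \<otimes>\<^bsub>subgroup_generated G (line k w)\<^esub> y) = f x \<otimes>\<^bsub>integer_group\<^esub> f y"
        using * by (simp add: f[of x s] f[of y t] f[of "x \<otimes> y" "s + t"])
    qed simp
    have "inj_on f (line k w)"
    proof (rule inj_onI)
      fix x y assume "x \<in> line k w" "y \<in> line k w" and eq: "f x = f y"
      then obtain s t where *: "x \<in> carrier G" "y \<in> carrier G"
        "\<Phi> x = (k * s * fst w, k * s * snd w)" "\<Phi> y = (k * t * fst w, k * t * snd w)"
        by (elim lineE)
      with eq have "s = t" using f[of x s] f[of y t] by simp
      with * show "x = y" by (simp flip: \<Phi>_inj)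
    qed
    moreover have "t \<in> f ` line k w" for t
    proof -
      obtain x where x: "x \<in> carrier G" "\<Phi> x = (k * t * fst w, k * t * snd w)"
        using \<Phi>_surj by blast
      then have "x \<in> line k w" by (rule lineI)
      then show ?thesis using f[OF x(2)] by blast
    qed
    ultimately show "bij_betw f (carrier (subgroup_generated G (line k w))) (carrier integer_group)"
      unfolding carr by (auto simp: bij_betw_def)
  qed
  then show ?thesis
    by (rule is_isoI)
qed

lemma line_quotient_line:
  assumes w: "coprime (fst w) (snd w)"
  shows "subgroup_generated G (line 1 w) Mod line (int m) w \<cong> integer_mod_group (m)"
proof -
  let ?A = "subgroup_generated G (line 1 w)" and ?H = "integer_mod_group (m)"
  obtain u v where uv: "u * fst w + v * snd w = 1"
    using bezout_int[of "fst w" "snd w"] w by auto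
  define f where "f = (\<lambda>x. (u * fst (\<Phi> x) + v * snd (\<Phi> x)) mod int m)"
  have carr: "carrier ?A = line 1 w"
    by (simp add: subgroup.carrier_subgroup_generated_subgroup[OF subgroup_line])
  have sub: "line 1 w \<subseteq> carrier G"
    by (auto simp: line_def)
  have f: "f \<in> hom ?A ?H"
    by (rule homI) (use sub in \<open>auto simp: carr f_def \<Phi>_mult subset_iff mod_in_integer_mod_group
        mod_add_eq algebra_simps\<close>)
  interpret f: group_hom ?A ?H f
    using f by (simp add: group_hom_def group_hom_axioms_def)
  have "carrier ?H \<subseteq> f ` carrier ?A"
  proof
    fix s assume s: "s \<in> carrier ?H"
    obtain x where x: "x \<in> carrier G" "\<Phi> x = (s * fst w, s * snd w)"
      using \<Phi>_surj by blast
    have "u * (s * fst w) + v * (s * snd w) = s * (u * fst w + v * snd w)"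
      by (simp add: algebra_simps)
    then have "f x = s"
      using uv mod_self_integer_mod_group[OF s] by (simp add: f_def x)
    moreover have "x \<in> line 1 w"
      by (rule lineI[where t = s]) (simp_all add: x)
    ultimately show "s \<in> f ` carrier ?A" unfolding carr by blast
  qed
  then have "f ` carrier ?A = carrier ?H"
    using hom_carrier[OF f] by blast
  moreover have "kernel ?A ?H f = line (int m) w"
    by (auto simp: kernel_def carr f_def mem_line_iff[OF uv] mod_eq_0_iff_dvd)
  ultimately show ?thesis
    using f.FactGroup_iso by simp
qed

end

subsection \<open>The normalized complex in coordinates\<close>

definition coords :: "nat \<Rightarrow> (bool list \<Rightarrow>\<^sub>0 int) \<Rightarrow> int \<times> int" where
  "coords n z = (Poly_Mapping.lookup z (alternating False n), Poly_Mapping.lookup z (alternating True n))"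

lemma carrier_chain_grp: "z \<in> carrier (chain_grp n) \<longleftrightarrow> Poly_Mapping.keys z \<subseteq> tuples n"
  by (simp add: chain_grp_def)

text \<open>Being supported on degenerate tuples means having coefficient 0 at both alternating
  ones. This lets the first isomorphism theorem identify the normalized chain group with the integer
  plane.\<close>

lemma kernel_coords: "kernel (chain_grp n) ZZ (coords n) = degenerate_chains n"
proof -
  have "Poly_Mapping.keys z \<subseteq> degenerate_tuples n \<longleftrightarrow> Poly_Mapping.keys z \<subseteq> tuples n \<and> coords n z = (0, 0)"
    for z
  proof
    assume *: "Poly_Mapping.keys z \<subseteq> degenerate_tuples n"
    then have "alternating s n \<notin> Poly_Mapping.keys z" for s
      by auto
    then show "Poly_Mapping.keys z \<subseteq> tuples n \<and> coords n z = (0, 0)"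
      using * by (auto simp: coords_def tuples_bool in_keys_iff)
  next
    assume *: "Poly_Mapping.keys z \<subseteq> tuples n \<and> coords n z = (0, 0)"
    then have "Poly_Mapping.lookup z (alternating s n) = 0" for s
      by (cases s) (auto simp: coords_def)
    then have "alternating s n \<notin> Poly_Mapping.keys z" for s
      by (simp add: in_keys_iff)
    then show "Poly_Mapping.keys z \<subseteq> degenerate_tuples n"
      using * by (auto simp: tuples_bool)
  qed
  then show ?thesis
    by (auto simp: kernel_def degenerate_chains_def carrier_chain_grp one_DirProd integer_group_def)
qed

interpretation coords: group_hom "chain_grp n" ZZ "coords n" for n
proof -
  have "coords n \<in> hom (chain_grp n) ZZ"
    by (rule homI) (auto simp: chain_grp_def coords_def Poly_Mapping.lookup_add integer_group_def)
  then show "group_hom (chain_grp n) ZZ (coords n)"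
    by (simp add: group_hom_def group_hom_axioms_def chain_grp_def)
qed

text \<open>This is the form in which \<open>FactGroup_iso_set\<close> provides the induced
  isomorphism.\<close>

definition norm_coords :: "nat \<Rightarrow> (bool list \<Rightarrow>\<^sub>0 int) set \<Rightarrow> int \<times> int" where
  "norm_coords n Z = the_elem (coords n ` Z)"

lemma coords_surj: "coords n ` carrier (chain_grp n) = carrier ZZ"
proof -
  have "v \<in> coords n ` carrier (chain_grp n)" for v
  proof
    let ?z = "frag_cmul (fst v) (frag_of (alternating False n))
      + frag_cmul (snd v) (frag_of (alternating True n))"
    show "v = coords n ?z"
      by (simp add: coords_def Poly_Mapping.lookup_add)
    have "Poly_Mapping.keys ?z \<subseteq> {alternating False n, alternating True n}"
      by (rule order_trans[OF keys_add]) (auto simp: split: if_splits)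
    then show "?z \<in> carrier (chain_grp n)"
      unfolding carrier_chain_grp by (rule order_trans) simp
  qed
  then show ?thesis by auto
qed

interpretation norm: coordinates "norm_chain_grp n" "norm_coords n" for n
proof -
  have "group (norm_chain_grp n :: (bool list \<Rightarrow>\<^sub>0 int) set monoid)"
    using normal.factorgroup_is_group[OF coords.normal_kernel[of n]]
    by (simp add: norm_chain_grp_def kernel_coords)
  moreover have "norm_coords n \<in> iso (norm_chain_grp n) ZZ"
    using coords.FactGroup_iso_set[OF coords_surj[of n]]
    by (simp add: norm_chain_grp_def kernel_coords norm_coords_def[abs_def])
  ultimately show "coordinates (norm_chain_grp n) (norm_coords n)"
    by (simp add: coordinates_def coordinates_axioms_def)
qed

lemma norm_chainE:
  assumes "Z \<in> carrier (norm_chain_grp n)"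
  obtains z where "z \<in> carrier (chain_grp n)" "Z = degenerate_chains n #>\<^bsub>chain_grp n\<^esub> z"
  using assms by (auto simp: norm_chain_grp_def FactGroup_def RCOSETS_def)

lemma norm_chainI:
  "z \<in> carrier (chain_grp n) \<Longrightarrow> degenerate_chains n #>\<^bsub>chain_grp n\<^esub> z \<in> carrier (norm_chain_grp n)"
  by (auto simp: norm_chain_grp_def FactGroup_def RCOSETS_def)

lemma norm_coords_coset:
  "z \<in> carrier (chain_grp n)
    \<Longrightarrow> norm_coords n (degenerate_chains n #>\<^bsub>chain_grp n\<^esub> z) = coords n z"
  using coords.the_elem_image_coset[of z n] by (simp add: norm_coords_def kernel_coords)

section \<open>The induced boundary, its image and its kernel\<close>

lemma lattice_boundary_closed:
  assumes "0 < n" "z \<in> carrier (chain_grp n)"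
  shows "lattice_boundary a b c d n z \<in> carrier (chain_grp (n - 1))"
proof -
  have *: "frag_cmul k (op_boundary opn n z) \<in> carrier (chain_grp (n - 1))" for k opn
    using keys_op_boundary[of n z opn] assms keys_cmul[of k "op_boundary opn n z"]
    by (simp add: carrier_chain_grp)
  have add: "x + y \<in> carrier (chain_grp (n - 1))"
    if "x \<in> carrier (chain_grp (n - 1))" "y \<in> carrier (chain_grp (n - 1))" for x y :: "'a list \<Rightarrow>\<^sub>0 int"
    using that keys_add[of x y] by (auto simp: carrier_chain_grp)
  show ?thesis
    unfolding lattice_boundary_def by (intro add *)
qed

context
  fixes a b c d p q :: int and m :: nat
  assumes ab: "a + b = int m * p" and ac: "a + c = int m * q" and pq: "coprime p q"
begin

definition direction :: "nat \<Rightarrow> int \<times> int" where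
  "direction n = (if even n then (-1, 1) else (p, q))"

definition det :: "int \<times> int \<Rightarrow> int \<times> int \<Rightarrow> int" where
  "det v w = fst v * snd w - snd v * fst w"

lemma coprime_direction: "coprime (fst (direction n)) (snd (direction n))"
  using pq by (simp add: direction_def)

text \<open>For even \<open>n\<close> both terms in a coordinate carry the same weight, giving the
  sum of the coordinates times \<open>(a + b, a + c)\<close>. For odd \<open>n\<close> the two
  resulting coordinates are opposite, giving a multiple of \<open>(-1, 1)\<close>.\<close>

lemma coords_lattice_boundary:
  assumes "0 < n" "z \<in> carrier (chain_grp n)"
  shows "coords (n - 1) (lattice_boundary a b c d n z)
    = (int m * det (coords n z) (direction n) * fst (direction (n - 1)),
       int m * det (coords n z) (direction n) * snd (direction (n - 1)))"
proof -
  have "even (n - 1) \<longleftrightarrow> odd n" using assms(1) by simp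
  then show ?thesis
    using assms(2) unfolding coords_def carrier_chain_grp
    by (simp add: lookup_lattice_boundary[OF assms(1)] ab ac direction_def det_def algebra_simps
        del: One_nat_def)
qed

text \<open>Well-definedness comes from the coordinate formula: members of one coset have equal
  coordinates, so their boundaries have equal coordinates and hence lie in one coset.\<close>

lemma norm_boundary_coset:
  fixes z :: "bool list \<Rightarrow>\<^sub>0 int"
  assumes "0 < n" "z \<in> carrier (chain_grp n)"
  shows "norm_boundary a b c d n (degenerate_chains n #>\<^bsub>chain_grp n\<^esub> z)
    = degenerate_chains (n - 1) #>\<^bsub>chain_grp (n - 1)\<^esub> lattice_boundary a b c d n z"
  unfolding norm_boundary_def
proof (rule the_elem_image_unique)
  have sub: "subgroup (degenerate_chains n) (chain_grp n :: (bool list \<Rightarrow>\<^sub>0 int) monoid)"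
    using coords.subgroup_kernel[of n] by (simp add: kernel_coords)
  show "degenerate_chains n #>\<^bsub>chain_grp n\<^esub> z \<noteq> {}"
    using coords.G.rcos_self[OF assms(2) sub] by blast
  fix y assume y: "y \<in> degenerate_chains n #>\<^bsub>chain_grp n\<^esub> z"
  then obtain e where e: "e \<in> kernel (chain_grp n) ZZ (coords n)" "y = e \<otimes>\<^bsub>chain_grp n\<^esub> z"
    by (auto simp: r_coset_def kernel_coords)
  then have "y \<in> carrier (chain_grp n)" "coords n y = coords n z"
    using assms(2) by (auto simp: kernel_def)
  then show "degenerate_chains (n - 1) #>\<^bsub>chain_grp (n - 1)\<^esub> lattice_boundary a b c d n y
      = degenerate_chains (n - 1) #>\<^bsub>chain_grp (n - 1)\<^esub> lattice_boundary a b c d n z"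
    unfolding kernel_coords[symmetric]
    by (intro coords.kernel_coset_eqI lattice_boundary_closed assms)
      (simp_all only: coords_lattice_boundary assms)
qed

lemma norm_boundary_coords:
  assumes "0 < n" "Z \<in> carrier (norm_chain_grp n)"
  shows "norm_boundary a b c d n Z \<in> carrier (norm_chain_grp (n - 1))"
    and "norm_coords (n - 1) (norm_boundary a b c d n Z)
    = (int m * det (norm_coords n Z) (direction n) * fst (direction (n - 1)),
       int m * det (norm_coords n Z) (direction n) * snd (direction (n - 1)))"
proof -
  obtain z where z: "z \<in> carrier (chain_grp n)" "Z = degenerate_chains n #>\<^bsub>chain_grp n\<^esub> z"
    using assms(2) by (rule norm_chainE)
  note closed = lattice_boundary_closed[OF assms(1) z(1), of a b c d]
  show "norm_boundary a b c d n Z \<in> carrier (norm_chain_grp (n - 1))"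
    unfolding z(2) norm_boundary_coset[OF assms(1) z(1)] by (rule norm_chainI[OF closed])
  show "norm_coords (n - 1) (norm_boundary a b c d n Z)
    = (int m * det (norm_coords n Z) (direction n) * fst (direction (n - 1)),
       int m * det (norm_coords n Z) (direction n) * snd (direction (n - 1)))"
    unfolding z(2) norm_boundary_coset[OF assms(1) z(1)] norm_coords_coset[OF closed]
      norm_coords_coset[OF z(1)] by (rule coords_lattice_boundary[OF assms(1) z(1)])
qed

lemma norm_boundary_image_eq_line:
  "norm_boundary_image a b c d (Suc n) = norm.line n (int m) (direction n)"
proof (intro subset_antisym subsetI)
  fix X :: "(bool list \<Rightarrow>\<^sub>0 int) set"
  assume "X \<in> norm_boundary_image a b c d (Suc n)"
  then obtain Z where "Z \<in> carrier (norm_chain_grp (Suc n))" "X = norm_boundary a b c d (Suc n) Z"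
    by (auto simp: norm_boundary_image_def)
  then show "X \<in> norm.line n (int m) (direction n)"
    using norm_boundary_coords[of "Suc n" Z] by (auto simp: norm.line_def multiples_def)
next
  fix X assume "X \<in> norm.line n (int m) (direction n)"
  then obtain t where X: "X \<in> carrier (norm_chain_grp n)"
    "norm_coords n X = (int m * t * fst (direction n), int m * t * snd (direction n))"
    by (auto simp: norm.line_def multiples_def)
  obtain u v where uv: "u * fst (direction (Suc n)) + v * snd (direction (Suc n)) = 1"
    using bezout_int[of "fst (direction (Suc n))" "snd (direction (Suc n))"]
      coprime_direction[of "Suc n"] by auto
  \<comment> \<open>By the Bezout identity this vector has determinant \<open>t\<close> against
    \<open>direction (Suc n)\<close>.\<close>
  obtain Z where Z: "Z \<in> carrier (norm_chain_grp (Suc n))" "norm_coords (Suc n) Z = (t * v, - t * u)"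
    using norm.\<Phi>_surj by blast
  have "det (t * v, - t * u) (direction (Suc n))
      = t * (u * fst (direction (Suc n)) + v * snd (direction (Suc n)))"
    by (simp add: det_def algebra_simps)
  then have "det (t * v, - t * u) (direction (Suc n)) = t"
    by (simp only: uv mult_1_right)
  then have "norm_boundary a b c d (Suc n) Z \<in> carrier (norm_chain_grp n)"
    "norm_coords n (norm_boundary a b c d (Suc n) Z) = norm_coords n X"
    using norm_boundary_coords[of "Suc n" Z] Z X(2) by simp_all
  then have "norm_boundary a b c d (Suc n) Z = X"
    using norm.\<Phi>_inj X(1) by blast
  then show "X \<in> norm_boundary_image a b c d (Suc n)"
    using Z(1) by (auto simp: norm_boundary_image_def)
qed

lemma norm_cycles_eq:
  assumes "0 < n"
  shows "norm_cycles a b c d n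
    = (if m = 0 then carrier (norm_chain_grp n) else norm.line n 1 (direction n))"
proof -
  obtain u v where uv: "u * fst (direction n) + v * snd (direction n) = 1"
    using bezout_int[of "fst (direction n)" "snd (direction n)"] coprime_direction[of n] by auto
  \<comment> \<open>A primitive vector is nonzero, so the boundary vanishes only if the scalar
    \<open>int m * det\<close> does.\<close>
  have nz: "fst (direction (n - 1)) \<noteq> 0 \<or> snd (direction (n - 1)) \<noteq> 0"
    using coprime_direction[of "n - 1"] by auto
  have "norm_boundary a b c d n Z = \<one>\<^bsub>norm_chain_grp (n - 1)\<^esub>
      \<longleftrightarrow> m = 0 \<or> det (norm_coords n Z) (direction n) = 0" if "Z \<in> carrier (norm_chain_grp n)" for Z
  proof -
    have "norm_boundary a b c d n Z = \<one>\<^bsub>norm_chain_grp (n - 1)\<^esub>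
      \<longleftrightarrow> norm_coords (n - 1) (norm_boundary a b c d n Z) = (0, 0)"
      using norm.\<Phi>_inj[OF norm_boundary_coords(1)[OF assms that] norm.one_closed]
      by (simp only: norm.\<Phi>_one)
    also have "\<dots> \<longleftrightarrow> m = 0 \<or> det (norm_coords n Z) (direction n) = 0"
      unfolding norm_boundary_coords(2)[OF assms that] using nz by auto
    finally show ?thesis .
  qed
  then have "norm_cycles a b c d n
      = {Z \<in> carrier (norm_chain_grp n). m = 0 \<or> det (norm_coords n Z) (direction n) = 0}"
    unfolding norm_cycles_def kernel_def by blast
  then show ?thesis
    by (simp add: set_eq_iff norm.mem_line_iff[OF uv] det_def)
qed

end

text \<open>In degree 0 the chain-level boundary is zero, and \<open>0 - 1 = 0\<close> makes the
  target \<open>norm_chain_grp 0\<close>; every coset is sent to its identity.\<close>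

lemma norm_cycles_0: "norm_cycles a b c d 0 = carrier (norm_chain_grp 0 :: (bool list \<Rightarrow>\<^sub>0 int) set monoid)"
proof -
  have "norm_boundary a b c d 0 Z = \<one>\<^bsub>norm_chain_grp 0\<^esub>"
    if Z: "Z \<in> carrier (norm_chain_grp 0)" for Z :: "(bool list \<Rightarrow>\<^sub>0 int) set"
  proof -
    obtain z where z: "z \<in> carrier (chain_grp 0)" "Z = degenerate_chains 0 #>\<^bsub>chain_grp 0\<^esub> z"
      using Z by (rule norm_chainE)
    have sub: "subgroup (degenerate_chains 0) (chain_grp 0 :: (bool list \<Rightarrow>\<^sub>0 int) monoid)"
      using coords.subgroup_kernel[of 0] by (simp add: kernel_coords)
    have "Z \<noteq> {}"
      using coords.G.rcos_self[OF z(1) sub] z(2) by blast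
    then have "norm_boundary a b c d 0 Z = degenerate_chains 0 #>\<^bsub>chain_grp 0\<^esub> \<one>\<^bsub>chain_grp 0\<^esub>"
      by (simp add: norm_boundary_def lattice_boundary_def op_boundary_def image_constant_conv
          chain_grp_def)
    also have "\<dots> = degenerate_chains 0"
      by (rule coords.G.coset_mult_one) (rule subgroup.subset[OF sub])
    finally show ?thesis
      by (simp add: norm_chain_grp_def)
  qed
  then show ?thesis
    by (auto simp: norm_cycles_def kernel_def)
qed

section \<open>Coprime cofactors and assembly of the statements\<close>

lemma gcd_decomposition:
  fixes x y :: int
  obtains p q where "x = gcd x y * p" "y = gcd x y * q" "coprime p q"
proof (cases "gcd x y = 0")
  case True
  then have "x = 0" "y = 0" by simp_all
  \<comment> \<open>With gcd 0 any coprime pair serves.\<close>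
  then show ?thesis by (intro that[of 1 0]) simp_all
next
  case False
  then obtain p q where pq: "x = p * gcd x y" "y = q * gcd x y" "coprime p q"
    using gcd_coprime_exists by blast
  show ?thesis
    by (rule that[OF trans[OF pq(1) mult.commute] trans[OF pq(2) mult.commute] pq(3)])
qed

theorem proposition9p3:
  fixes a b c d :: int
  shows
    "(\<forall>n. (norm_chain_grp n :: (bool list \<Rightarrow>\<^sub>0 int) set monoid) Mod norm_boundary_image a b c d (Suc n)
            \<cong> integer_group \<times>\<times> integer_mod_group (nat (gcd (a + b) (a + c))))
     \<and>
     (\<forall>n>0. if a + b = 0 \<and> a + c = 0
        then (norm_boundary_image a b c d n :: (bool list \<Rightarrow>\<^sub>0 int) set set)
               = {\<one>\<^bsub>norm_chain_grp (n - 1)\<^esub>}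
        else subgroup_generated (norm_chain_grp (n - 1))
               (norm_boundary_image a b c d n :: (bool list \<Rightarrow>\<^sub>0 int) set set)
               \<cong> integer_group)
     \<and>
     (\<forall>n>0. if a + b = 0 \<and> a + c = 0
        then (norm_homology a b c d n :: (bool list \<Rightarrow>\<^sub>0 int) set set monoid)
               \<cong> integer_group \<times>\<times> integer_group
        else (norm_homology a b c d n :: (bool list \<Rightarrow>\<^sub>0 int) set set monoid)
               \<cong> integer_mod_group (nat (gcd (a + b) (a + c))))
     \<and>
     (norm_homology a b c d 0 :: (bool list \<Rightarrow>\<^sub>0 int) set set monoid)
        = norm_chain_grp 0 Mod norm_boundary_image a b c d (Suc 0)
     \<and>
     (norm_homology a b c d 0 :: (bool list \<Rightarrow>\<^sub>0 int) set set monoid)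
        \<cong> integer_group \<times>\<times> integer_mod_group (nat (gcd (a + b) (a + c)))"
proof -
  define m where "m = nat (gcd (a + b) (a + c))"
  have gm: "gcd (a + b) (a + c) = int m"
    by (simp add: m_def)
  have m0: "a + b = 0 \<and> a + c = 0 \<longleftrightarrow> m = 0"
    using gm gcd_eq_0_iff[of "a + b" "a + c"] by simp
  obtain p q where pq: "a + b = int m * p" "a + c = int m * q" "coprime p q"
    using gcd_decomposition[of "a + b" "a + c"] unfolding gm by blast
  define w where "w = direction p q"
  note image = norm_boundary_image_eq_line[OF pq, of d, folded w_def]
    and cycles = norm_cycles_eq[OF pq, of _ d, folded w_def]
    and coprime = coprime_direction[OF pq, folded w_def]
  have cokernel: "(norm_chain_grp n :: (bool list \<Rightarrow>\<^sub>0 int) set monoid)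
      Mod norm_boundary_image a b c d (Suc n) \<cong> integer_group \<times>\<times> integer_mod_group m" for n
    unfolding image by (rule norm.quotient_line[OF coprime])
  have image_0: "norm.line n 0 v = {\<one>\<^bsub>norm_chain_grp n\<^esub>}" for n v
    using norm.\<Phi>_inj[of _ n "\<one>\<^bsub>norm_chain_grp n\<^esub>"]
    by (auto simp: norm.line_def multiples_def norm.\<Phi>_one)
  have boundaries: "if m = 0
      then (norm_boundary_image a b c d n :: (bool list \<Rightarrow>\<^sub>0 int) set set) = {\<one>\<^bsub>norm_chain_grp (n - 1)\<^esub>}
      else subgroup_generated (norm_chain_grp (n - 1))
        (norm_boundary_image a b c d n :: (bool list \<Rightarrow>\<^sub>0 int) set set) \<cong> integer_group"
    if "0 < n" for n
    using image[of "n - 1"] that norm.line_cong_integer_group[OF coprime, of "int m" "n - 1" "n - 1"]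
    by (simp add: image_0)
  \<comment> \<open>For \<open>m = 0\<close> all chains are cycles, so homology is the cokernel
    computed above.\<close>
  have "(norm_homology a b c d n :: (bool list \<Rightarrow>\<^sub>0 int) set set monoid)
      = norm_chain_grp n Mod norm_boundary_image a b c d (Suc n)" if "m = 0" "0 < n" for n
    using that by (simp add: norm_homology_def cycles norm.subgroup_generated_group_carrier)
  then have homology: "if m = 0
      then (norm_homology a b c d n :: (bool list \<Rightarrow>\<^sub>0 int) set set monoid) \<cong> integer_group \<times>\<times> integer_group
      else (norm_homology a b c d n :: (bool list \<Rightarrow>\<^sub>0 int) set set monoid) \<cong> integer_mod_group m"
    if "0 < n" for n
    using that cokernel[of n] norm.line_quotient_line[OF coprime, of n n m]
    \<comment> \<open>Unfolding turns \<open>integer_mod_group 0\<close> into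
      \<open>integer_group\<close>, which yields the second free summand.\<close>
    by (auto simp: integer_mod_group_def norm_homology_def cycles image)
  have homology_0: "(norm_homology a b c d 0 :: (bool list \<Rightarrow>\<^sub>0 int) set set monoid)
      = norm_chain_grp 0 Mod norm_boundary_image a b c d (Suc 0)"
    by (simp add: norm_homology_def norm_cycles_0 norm.subgroup_generated_group_carrier)
  show ?thesis
    using cokernel boundaries homology homology_0 cokernel[of 0]
    unfolding m0 m_def[symmetric] by auto
qed

end
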